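(* Let $\tau:\mathbb{U}\to\Omega$, $\tau(z)=\frac{az+b}{cz+d}$, be a linear fractional Riemann map, and let $\Phi$ be an analytic self-map of $\Omega$ such that $C_{\Phi}$ is a Hermitian composition operator on $H^{2}(\Omega)$. (1) If $|c|^{2}=|d|^{2}$, then there is $r\in\mathbb{C}$ with $\overline{r}(b\overline{d}-a\overline{c})\in\mathbb{R}$ such that $\Phi(w)=w+r$ for all $w\in\Omega$. (2) If $|c|^{2}\neq|d|^{2}$, then there is $r\in\mathbb{R}$ such that $\Phi(w)=rw+\frac{(r-1)(b\overline{d}-a\overline{c})}{|c|^{2}-|d|^{2}}$ for all $w\in\Omega$. Conversely, suppose that either $|c|^2=|d|^2$ and $\Phi(w)=w+r$ with $r\in\mathbb{C}$, $\overline{r}(b\overline{d}-a\overline{c})\in\mathbb{R}$, or $|c|^2\neq|d|^2$ and $\Phi(w)=rw+\frac{(r-1)(b\overline{d}-a\overline{c})}{|c|^{2}-|d|^{2}}$ with $r\in\mathbb{R}$. If $\Phi$ is a self-map of $\Omega$ such that $C_{\Phi}$ is bounded on $H^{2}(\Omega)$, then $C_{\Phi}$ is Hermitian.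
   Context: $\mathbb{U}$ is the open unit disc and $\Omega$ is an open simply connected proper subset of $\mathbb{C}$. A Riemann map $\tau:\mathbb{U}\to\Omega$ is a biholomorphic map of $\mathbb{U}$ onto $\Omega$; it is a linear fractional Riemann map if $\tau(z)=\frac{az+b}{cz+d}$ with $a,b,c,d\in\mathbb{C}$, $ad-bc\neq0$. The Hardy-Smirnov space $H^{2}(\Omega)$ is the set of analytic $f:\Omega\to\mathbb{C}$ with $\|f\|^{2}=\sup_{0<r<1}\frac{1}{2\pi}\int_{\Gamma_r}|f(w)|^{2}|dw|<\infty$, where $\Gamma_r=\tau(\{|z|=r\})$; the norm is the one induced by the given $\tau$. Fix an analytic branch of $(\tau')^{1/2}$ on $\mathbb{U}$. The map $Vf=(f\circ\tau)(\tau')^{1/2}$ is an isometric isomorphism from $H^2(\Omega)$ onto the classical Hardy space $H^2(\mathbb{U})$, and $H^{2}(\Omega)$ is a Hilbert space with inner product $\langle f,g\rangle=\langle Vf,Vg\rangle_{2}$, where $\langle\cdot,\cdot\rangle_2$ is the inner product of $H^2(\mathbb{U})$, $\langle F,G\rangle_2=\sum_{n\ge0}\widehat F(n)\overline{\widehat G(n)}$ (Maclaurin coefficients). For an analytic self-map $\Phi$ of $\Omega$, $C_{\Phi}f=f\circ\Phi$. A bounded operator $T$ is Hermitian if $T=T^*$. *)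

theory Defs
  imports "HOL-Complex_Analysis.Complex_Analysis"
begin

abbreviation unit_disc :: "complex set" where
  "unit_disc \<equiv> ball 0 1"

definition riemann_map :: "(complex \<Rightarrow> complex) \<Rightarrow> complex set \<Rightarrow> bool" where
  "riemann_map \<tau> \<Omega> \<longleftrightarrow>
     \<tau> holomorphic_on unit_disc \<and> \<tau> ` unit_disc = \<Omega> \<and>
     (\<exists>g. g holomorphic_on \<Omega> \<and> (\<forall>z\<in>unit_disc. g (\<tau> z) = z) \<and> (\<forall>w\<in>\<Omega>. \<tau> (g w) = w))"

text \<open>
  Together with \<open>riemann_map \<tau> \<Omega>\<close>, the following forces \<open>c * z + d \<noteq> 0\<close> on the disc: at a
  zero of the denominator \<open>\<tau>\<close> would be unbounded nearby, hence not holomorphic.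
\<close>

definition linear_fractional_on ::
    "complex set \<Rightarrow> complex \<Rightarrow> complex \<Rightarrow> complex \<Rightarrow> complex \<Rightarrow> (complex \<Rightarrow> complex) \<Rightarrow> bool" where
  "linear_fractional_on S a b c d \<tau> \<longleftrightarrow>
     a * d - b * c \<noteq> 0 \<and> (\<forall>z\<in>S. \<tau> z = (a * z + b) / (c * z + d))"

definition deriv_sqrt_branch :: "(complex \<Rightarrow> complex) \<Rightarrow> (complex \<Rightarrow> complex) \<Rightarrow> bool" where
  "deriv_sqrt_branch \<tau> \<sigma> \<longleftrightarrow>
     \<sigma> holomorphic_on unit_disc \<and> (\<forall>z\<in>unit_disc. (\<sigma> z)\<^sup>2 = deriv \<tau> z)"

definition arclength_integral :: "(real \<Rightarrow> complex) \<Rightarrow> (complex \<Rightarrow> real) \<Rightarrow> real" where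
  "arclength_integral \<gamma> u =
     integral {0..1} (\<lambda>t. u (\<gamma> t) * norm (vector_derivative \<gamma> (at t)))"

text \<open>
  The curve \<open>\<tau> \<circ> circlepath 0 r\<close> runs once through the image under \<open>\<tau>\<close> of the circle of
  radius \<open>r\<close>, since \<open>\<tau>\<close> is injective on the disc.
\<close>

definition hs_mean :: "(complex \<Rightarrow> complex) \<Rightarrow> (complex \<Rightarrow> complex) \<Rightarrow> real \<Rightarrow> real" where
  "hs_mean \<tau> f r =
     1 / (2 * pi) * arclength_integral (\<tau> \<circ> circlepath 0 r) (\<lambda>w. (cmod (f w))\<^sup>2)"

text \<open>
  Elements of the Hardy-Smirnov space are represented by total functions; only their values on
  \<open>\<Omega>\<close> matter, and two representatives denote the same element iff they agree on \<open>\<Omega>\<close>.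
\<close>

definition hs_space :: "(complex \<Rightarrow> complex) \<Rightarrow> complex set \<Rightarrow> (complex \<Rightarrow> complex) set" where
  "hs_space \<tau> \<Omega> = {f. f holomorphic_on \<Omega> \<and> bdd_above (hs_mean \<tau> f ` {0<..<1})}"

definition hs_norm :: "(complex \<Rightarrow> complex) \<Rightarrow> (complex \<Rightarrow> complex) \<Rightarrow> real" where
  "hs_norm \<tau> f = sqrt (SUP r\<in>{0<..<1}. hs_mean \<tau> f r)"

definition maclaurin_coeff :: "(complex \<Rightarrow> complex) \<Rightarrow> nat \<Rightarrow> complex" where
  "maclaurin_coeff F n = (deriv ^^ n) F 0 / fact n"

definition hardy_inner :: "(complex \<Rightarrow> complex) \<Rightarrow> (complex \<Rightarrow> complex) \<Rightarrow> complex" where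
  "hardy_inner F G = (\<Sum>n. maclaurin_coeff F n * cnj (maclaurin_coeff G n))"

definition hs_V ::
    "(complex \<Rightarrow> complex) \<Rightarrow> (complex \<Rightarrow> complex) \<Rightarrow> (complex \<Rightarrow> complex) \<Rightarrow> complex \<Rightarrow> complex" where
  "hs_V \<tau> \<sigma> f = (\<lambda>z. f (\<tau> z) * \<sigma> z)"

definition hs_inner ::
    "(complex \<Rightarrow> complex) \<Rightarrow> (complex \<Rightarrow> complex) \<Rightarrow> (complex \<Rightarrow> complex) \<Rightarrow> (complex \<Rightarrow> complex) \<Rightarrow> complex" where
  "hs_inner \<tau> \<sigma> f g = hardy_inner (hs_V \<tau> \<sigma> f) (hs_V \<tau> \<sigma> g)"

definition hs_bounded_operator ::
    "(complex \<Rightarrow> complex) \<Rightarrow> complex set \<Rightarrow> ((complex \<Rightarrow> complex) \<Rightarrow> complex \<Rightarrow> complex) \<Rightarrow> bool" where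
  "hs_bounded_operator \<tau> \<Omega> T \<longleftrightarrow>
     (\<forall>f\<in>hs_space \<tau> \<Omega>. T f \<in> hs_space \<tau> \<Omega>) \<and>
     (\<forall>f\<in>hs_space \<tau> \<Omega>. \<forall>g\<in>hs_space \<tau> \<Omega>. \<forall>\<alpha> \<beta>. \<forall>w\<in>\<Omega>.
        T (\<lambda>x. \<alpha> * f x + \<beta> * g x) w = \<alpha> * T f w + \<beta> * T g w) \<and>
     (\<exists>M. \<forall>f\<in>hs_space \<tau> \<Omega>. hs_norm \<tau> (T f) \<le> M * hs_norm \<tau> f)"

text \<open>
  \<open>S\<close> is the Hilbert space adjoint of \<open>T\<close>. It is a relation because operators are only
  determined by their values on \<open>\<Omega>\<close>; up to this identification the adjoint is unique.
\<close>

definition hs_adjoint ::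
    "(complex \<Rightarrow> complex) \<Rightarrow> (complex \<Rightarrow> complex) \<Rightarrow> complex set \<Rightarrow>
     ((complex \<Rightarrow> complex) \<Rightarrow> complex \<Rightarrow> complex) \<Rightarrow> ((complex \<Rightarrow> complex) \<Rightarrow> complex \<Rightarrow> complex) \<Rightarrow> bool" where
  "hs_adjoint \<tau> \<sigma> \<Omega> T S \<longleftrightarrow>
     hs_bounded_operator \<tau> \<Omega> S \<and>
     (\<forall>f\<in>hs_space \<tau> \<Omega>. \<forall>g\<in>hs_space \<tau> \<Omega>. hs_inner \<tau> \<sigma> (T f) g = hs_inner \<tau> \<sigma> f (S g))"

definition hs_hermitian ::
    "(complex \<Rightarrow> complex) \<Rightarrow> (complex \<Rightarrow> complex) \<Rightarrow> complex set \<Rightarrow>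
     ((complex \<Rightarrow> complex) \<Rightarrow> complex \<Rightarrow> complex) \<Rightarrow> bool" where
  "hs_hermitian \<tau> \<sigma> \<Omega> T \<longleftrightarrow> hs_bounded_operator \<tau> \<Omega> T \<and> hs_adjoint \<tau> \<sigma> \<Omega> T T"

definition composition_operator ::
    "(complex \<Rightarrow> complex) \<Rightarrow> (complex \<Rightarrow> complex) \<Rightarrow> complex \<Rightarrow> complex" where
  "composition_operator \<Phi> f = f \<circ> \<Phi>"

end

theory Submission
  imports Defs
begin

text \<open>
  For a linear fractional \<open>\<tau>\<close> one has \<open>\<sigma> z = \<kappa> / (c z + d)\<close>, and the reproducing kernel of
  \<open>H\<^sup>2(\<Omega>)\<close> at \<open>w\<close> is \<open>v \<mapsto> |ad - bc| / D(v, w)\<close>, where \<open>D\<close> is affine in \<open>v\<close> and in the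
  conjugate of \<open>w\<close>. Testing self-adjointness on kernels gives \<open>D(\<Phi> v, w) = D(v, \<Phi> w)\<close> for
  all \<open>v, w\<close>, and this equation determines \<open>\<Phi>\<close> by separation of variables.

  Conversely, if this equation holds then \<open>C\<^sub>\<Phi>\<close> maps the kernel at \<open>w\<close> to the kernel at \<open>\<Phi> w\<close>, so the
  bounded functional \<open>g \<mapsto> \<langle>C\<^sub>\<Phi> g, f\<rangle> - \<langle>g, C\<^sub>\<Phi> f\<rangle>\<close> vanishes at all kernels. Its values at the
  orthonormal basis \<open>V\<^sup>-\<^sup>1 z\<^sup>n\<close> are the coefficients of a power series whose sum on the disc is its value
  at the kernels (up to a nonzero factor), hence they vanish, and the functional is zero.
\<close>

section \<open>Maclaurin coefficients and Parseval's identity on circles\<close>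

lemma maclaurin_coeff_sums:
  assumes "F holomorphic_on unit_disc" "z \<in> unit_disc"
  shows "(\<lambda>n. maclaurin_coeff F n * z ^ n) sums F z"
  using holomorphic_power_series[OF assms] by (simp add: maclaurin_coeff_def)

text \<open>Any power series converging to \<open>F\<close> pointwise on the disc is a formal
  expansion of \<open>F\<close> at 0, so its coefficients are forced. The coefficient formulas below
  all rest on this.\<close>

lemma maclaurin_coeff_unique:
  assumes "\<And>z. z \<in> unit_disc \<Longrightarrow> (\<lambda>n. u n * z ^ n) sums F z"
  shows "maclaurin_coeff F n = u n"
proof -
  have "eventually (\<lambda>z. z \<in> unit_disc) (nhds (0::complex))"
    by (intro eventually_nhds_in_open) auto
  then have "F has_fps_expansion Abs_fps u"
    by (intro has_fps_expansionI) (auto elim!: eventually_mono intro: assms)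
  from fps_nth_fps_expansion[OF this] show ?thesis
    by (simp add: maclaurin_coeff_def)
qed

lemma maclaurin_coeff_lincomb:
  assumes "F holomorphic_on unit_disc" "G holomorphic_on unit_disc"
  shows "maclaurin_coeff (\<lambda>z. \<alpha> * F z + \<beta> * G z) n
           = \<alpha> * maclaurin_coeff F n + \<beta> * maclaurin_coeff G n"
proof (rule maclaurin_coeff_unique)
  fix z :: complex assume z: "z \<in> unit_disc"
  show "(\<lambda>n. (\<alpha> * maclaurin_coeff F n + \<beta> * maclaurin_coeff G n) * z ^ n) sums (\<alpha> * F z + \<beta> * G z)"
    using sums_add[OF sums_mult[OF maclaurin_coeff_sums[OF assms(1) z], of \<alpha>]
                      sums_mult[OF maclaurin_coeff_sums[OF assms(2) z], of \<beta>]]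
    by (simp add: algebra_simps)
qed

text \<open>Cauchy's formula for the n-th derivative, using that on the circle inverse powers of
  \<open>u\<close> are powers of \<open>cnj u\<close> up to powers of \<open>r\<close>. Since
  \<open>circlepath\<close> is parametrised by [0,1], integration in \<open>t\<close> is already the
  normalised mean.\<close>

lemma maclaurin_coeff_integral:
  assumes "F holomorphic_on unit_disc" "0 < r" "r < 1"
  shows "((\<lambda>t. F (circlepath 0 r t) * cnj (circlepath 0 r t ^ n))
           has_integral (maclaurin_coeff F n * of_real (r ^ (2 * n)))) {0..1}"
proof -
  have sub: "cball 0 r \<subseteq> (unit_disc :: complex set)" "ball 0 r \<subseteq> (unit_disc :: complex set)"
    using assms by auto
  have "((\<lambda>u. F u / u ^ Suc n) has_contour_integral
          (2 * pi * \<i> / fact n * (deriv ^^ n) F 0)) (circlepath 0 r)"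
    using Cauchy_has_contour_integral_higher_derivative_circlepath[of 0 r F 0 n] assms sub
    by (simp add: holomorphic_on_imp_continuous_on holomorphic_on_subset
        continuous_on_subset[of unit_disc])
  then have I: "((\<lambda>t. F (circlepath 0 r t) / circlepath 0 r t ^ Suc n *
          vector_derivative (circlepath 0 r) (at t within {0..1})) has_integral
          (2 * pi * \<i> * maclaurin_coeff F n)) {0..1}"
    by (simp add: has_contour_integral_def maclaurin_coeff_def)
  \<comment> \<open>The factor is chosen to cancel the \<open>2 * pi * \<i>\<close> of the velocity
    and, as \<open>r ^ (2 * n) = u ^ n * cnj u ^ n\<close>, to turn division by \<open>u ^ n\<close>
    into multiplication by \<open>cnj u ^ n\<close>.\<close>
  have "((\<lambda>t. of_real (r ^ (2 * n)) / (2 * pi * \<i>) * (F (circlepath 0 r t) / circlepath 0 r t ^ Suc n *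
          vector_derivative (circlepath 0 r) (at t within {0..1}))) has_integral
          (of_real (r ^ (2 * n)) / (2 * pi * \<i>) * (2 * pi * \<i> * maclaurin_coeff F n))) {0..1}"
    by (rule has_integral_mult_right[OF I])
  moreover have "of_real (r ^ (2 * n)) / (2 * pi * \<i>) * (F (circlepath 0 r t) / circlepath 0 r t ^ Suc n *
          vector_derivative (circlepath 0 r) (at t within {0..1}))
        = F (circlepath 0 r t) * cnj (circlepath 0 r t ^ n)" if "t \<in> {0..1}" for t
  proof -
    define w where "w = circlepath 0 r t"
    have w0: "w \<noteq> 0" and nw: "cmod w = r"
      using assms by (auto simp: w_def circlepath norm_mult)
    have vd: "vector_derivative (circlepath 0 r) (at t within {0..1}) = 2 * pi * \<i> * w"
      using that by (subst vector_derivative_circlepath01) (simp_all add: w_def circlepath)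
    have "of_real (r ^ (2 * n)) = w ^ n * cnj w ^ n"
      unfolding power_mult_distrib[symmetric] complex_norm_square[symmetric] nw
      by (simp add: power_mult)
    then show ?thesis
      unfolding vd w_def[symmetric] using w0 by (simp add: field_simps)
  qed
  ultimately show ?thesis
    by (subst has_integral_cong[where g = "\<lambda>t. of_real (r ^ (2 * n)) / (2 * pi * \<i>) * (F (circlepath 0 r t) / circlepath 0 r t ^ Suc n *
          vector_derivative (circlepath 0 r) (at t within {0..1}))"]) (simp_all add: mult.commute)
qed

text \<open>Only the conjugated factor of \<open>F * cnj F\<close> is replaced by partial sums, so
  each integral is a finite sum of coefficient integrals and no double series appears. Uniform
  convergence on the circle gives the limit.\<close>

lemma parseval_circle:
  assumes hol: "F holomorphic_on unit_disc" and r: "0 < r" "r < 1"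
  shows "(\<lambda>n. (cmod (maclaurin_coeff F n))\<^sup>2 * r ^ (2 * n)) sums
           integral {0..1} (\<lambda>t. (cmod (F (circlepath 0 r t)))\<^sup>2)"
proof -
  let ?a = "maclaurin_coeff F" and ?\<gamma> = "circlepath 0 r"
  have \<gamma>: "?\<gamma> ` {0..1} \<subseteq> cball 0 r"
    using r by (auto simp: circlepath norm_mult)
  have sub: "cball 0 r \<subseteq> (unit_disc :: complex set)"
    using r by auto
  have cF: "continuous_on (cball 0 r) F"
    using hol holomorphic_on_imp_continuous_on continuous_on_subset sub by blast
  have c\<gamma>: "continuous_on {0..1} ?\<gamma>"
    unfolding circlepath by (intro continuous_intros)
  have cF\<gamma>: "continuous_on {0..1} (\<lambda>t. F (?\<gamma> t))"
    by (rule continuous_on_compose2[OF cF c\<gamma> \<gamma>])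
  \<comment> \<open>The series converges at \<open>(r + 1) / 2\<close>, which lies strictly between
    \<open>r\<close> and 1; a radius of convergence strictly above \<open>r\<close> yields uniform
    convergence on \<open>cball 0 r\<close>.\<close>
  have "ereal r < conv_radius ?a"
  proof -
    have "summable (\<lambda>n. ?a n * of_real ((r + 1) / 2) ^ n)"
      using maclaurin_coeff_sums[OF hol, of "of_real ((r + 1) / 2)"] r
      by (intro sums_summable[of _ "F (of_real ((r + 1) / 2))"]) (simp del: of_real_add of_real_divide)
    from conv_radius_geI[OF this] have "ereal ((r + 1) / 2) \<le> conv_radius ?a"
      using r by (simp del: of_real_add of_real_divide)
    moreover have "ereal r < ereal ((r + 1) / 2)" using r by simp
    ultimately show ?thesis by (rule less_le_trans[rotated])
  qed
  from powser_uniform_limit[OF this, of 0]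
  have "uniform_limit (cball 0 r) (\<lambda>N x. \<Sum>i<N. ?a i * x ^ i) (\<lambda>x. \<Sum>i. ?a i * x ^ i) sequentially"
    by simp
  also have "?this \<longleftrightarrow> uniform_limit (cball 0 r) (\<lambda>N x. \<Sum>i<N. ?a i * x ^ i) F sequentially"
    using maclaurin_coeff_sums[OF hol] sub by (intro uniform_limit_cong') (auto simp: sums_iff)
  finally have "uniform_limit {0..1} (\<lambda>N t. \<Sum>i<N. ?a i * ?\<gamma> t ^ i) (\<lambda>t. F (?\<gamma> t)) sequentially"
    unfolding uniform_limit_iff using \<gamma>
    by (elim all_forward imp_forward eventually_mono) (auto simp: image_subset_iff)
  then have "uniform_limit {0..1} (\<lambda>N t. F (?\<gamma> t) * cnj (\<Sum>i<N. ?a i * ?\<gamma> t ^ i))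
               (\<lambda>t. F (?\<gamma> t) * cnj (F (?\<gamma> t))) sequentially"
    using compact_imp_bounded[OF compact_continuous_image[OF cF\<gamma>]]
      compact_imp_bounded[OF compact_continuous_image[OF continuous_on_cnj[OF cF\<gamma>]]]
    by (intro uniform_limit_intros) auto
  then obtain I J where I: "\<And>N. ((\<lambda>t. F (?\<gamma> t) * cnj (\<Sum>i<N. ?a i * ?\<gamma> t ^ i)) has_integral I N) {0..1}"
      and J: "((\<lambda>t. F (?\<gamma> t) * cnj (F (?\<gamma> t))) has_integral J) {0..1}"
      and lim: "I \<longlonglongrightarrow> J"
    by (rule uniform_limit_integral)
       (auto intro!: continuous_intros cF\<gamma> c\<gamma>)
  have "I = (\<lambda>N. \<Sum>i<N. of_real ((cmod (?a i))\<^sup>2 * r ^ (2 * i)))"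
  proof (rule ext, rule has_integral_unique[OF I])
    fix N
    have "((\<lambda>t. \<Sum>i<N. cnj (?a i) * (F (?\<gamma> t) * cnj (?\<gamma> t ^ i))) has_integral
           (\<Sum>i<N. cnj (?a i) * (?a i * of_real (r ^ (2 * i))))) {0..1}"
      by (intro has_integral_sum has_integral_mult_right maclaurin_coeff_integral assms) auto
    then show "((\<lambda>t. F (?\<gamma> t) * cnj (\<Sum>i<N. ?a i * ?\<gamma> t ^ i)) has_integral
           (\<Sum>i<N. of_real ((cmod (?a i))\<^sup>2 * r ^ (2 * i)))) {0..1}"
      by (simp add: sum_distrib_left complex_norm_square mult_ac del: of_real_power)
  qed
  with lim have "(\<lambda>n. complex_of_real ((cmod (?a n))\<^sup>2 * r ^ (2 * n))) sums J"
    by (simp only: sums_def)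
  then have "(\<lambda>n. (cmod (?a n))\<^sup>2 * r ^ (2 * n)) sums Re J"
    by (drule_tac sums_Re) simp
  moreover have "((\<lambda>t. (cmod (F (?\<gamma> t)))\<^sup>2) has_integral Re J) {0..1}"
    using has_integral_Re[OF J] by (simp add: complex_norm_square[symmetric] del: of_real_power)
  ultimately show ?thesis
    by (simp add: integral_unique)
qed

section \<open>Square-summable sequences and Abel means\<close>

lemma l2_summable_mult:
  fixes x y :: "nat \<Rightarrow> complex"
  assumes "summable (\<lambda>n. (cmod (x n))\<^sup>2)" "summable (\<lambda>n. (cmod (y n))\<^sup>2)"
  shows "summable (\<lambda>n. cmod (x n * cnj (y n)))"
proof (rule summable_comparison_test')
  show "summable (\<lambda>n. (cmod (x n))\<^sup>2 + (cmod (y n))\<^sup>2)"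
    using assms by (rule summable_add)
  show "norm (cmod (x n * cnj (y n))) \<le> (cmod (x n))\<^sup>2 + (cmod (y n))\<^sup>2" for n
    using sum_squares_bound[of "cmod (x n)" "cmod (y n)"] mult_nonneg_nonneg[OF norm_ge_zero[of "x n"] norm_ge_zero[of "y n"]]
    unfolding real_norm_def norm_mult complex_mod_cnj by linarith
qed

lemma l2_Cauchy_Schwarz:
  fixes x y :: "nat \<Rightarrow> complex"
  assumes x: "summable (\<lambda>n. (cmod (x n))\<^sup>2)" and y: "summable (\<lambda>n. (cmod (y n))\<^sup>2)"
  shows "cmod (\<Sum>n. x n * cnj (y n)) \<le> sqrt (\<Sum>n. (cmod (x n))\<^sup>2) * sqrt (\<Sum>n. (cmod (y n))\<^sup>2)"
proof -
  note s = l2_summable_mult[OF x y]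
  have "cmod (\<Sum>n. x n * cnj (y n)) \<le> (\<Sum>n. cmod (x n * cnj (y n)))"
    by (rule summable_norm[OF s])
  also have "\<dots> \<le> sqrt (\<Sum>n. (cmod (x n))\<^sup>2) * sqrt (\<Sum>n. (cmod (y n))\<^sup>2)"
  proof (rule suminf_le_const[OF s])
    fix N
    have "(\<Sum>n<N. cmod (x n * cnj (y n))) = (\<Sum>n<N. \<bar>cmod (x n)\<bar> * \<bar>cmod (y n)\<bar>)"
      by (simp add: norm_mult)
    also have "\<dots> \<le> sqrt (\<Sum>n<N. (cmod (x n))\<^sup>2) * sqrt (\<Sum>n<N. (cmod (y n))\<^sup>2)"
      using L2_set_mult_ineq[of "\<lambda>n. cmod (x n)" "\<lambda>n. cmod (y n)" "{..<N}"]
      unfolding L2_set_def .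
    also have "\<dots> \<le> sqrt (\<Sum>n. (cmod (x n))\<^sup>2) * sqrt (\<Sum>n. (cmod (y n))\<^sup>2)"
      by (intro mult_mono real_sqrt_le_mono sum_le_suminf x y) (auto intro!: suminf_nonneg x sum_nonneg)
    finally show "(\<Sum>n<N. cmod (x n * cnj (y n))) \<le> \<dots>" .
  qed
  finally show ?thesis .
qed

text \<open>\<open>r * P\<close> has the shape of a Hardy-Smirnov mean over the circle of radius
  \<open>r\<close>, the factor \<open>r\<close> coming from arc length.\<close>

lemma abel_mean_le_suminf:
  fixes u :: "nat \<Rightarrow> real"
  assumes u: "\<And>n. 0 \<le> u n" "summable u" and r: "0 < r" "r < 1"
    and P: "(\<lambda>n. u n * r ^ (2 * n)) sums P"
  shows "r * P \<le> suminf u"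
proof -
  have "P \<le> suminf u"
    using P u r by (intro sums_le[OF _ P summable_sums]) (auto intro!: mult_left_le power_le_one)
  moreover have "0 \<le> P"
    using sums_le[OF _ sums_zero P] u(1) r by auto
  ultimately show ?thesis
    using mult_right_mono[of r 1 P] r by simp
qed

text \<open>Each partial sum with the powers of \<open>r\<close> inserted is a polynomial in
  \<open>r\<close> bounded by \<open>B\<close> on (0,1); letting \<open>r\<close> tend to 1 bounds
  the partial sums of \<open>u\<close> themselves.\<close>

lemma abel_mean_bounded:
  fixes u :: "nat \<Rightarrow> real"
  assumes u: "\<And>n. 0 \<le> u n" and P: "\<And>r. 0 < r \<Longrightarrow> r < 1 \<Longrightarrow> (\<lambda>n. u n * r ^ (2 * n)) sums P r"
    and bd: "\<And>r. 0 < r \<Longrightarrow> r < 1 \<Longrightarrow> r * P r \<le> B"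
  shows "summable u" "suminf u \<le> B"
proof -
  have part: "(\<Sum>n<N. u n) \<le> B" for N
  proof (rule tendsto_upperbound)
    show "((\<lambda>r. r * (\<Sum>n<N. u n * r ^ (2 * n))) \<longlongrightarrow> (\<Sum>n<N. u n)) (at_left 1)"
      by (auto intro!: tendsto_eq_intros)
    have "eventually (\<lambda>r::real. r \<in> {0<..<1}) (at_left 1)"
      by (rule eventually_at_left_real) simp
    then show "eventually (\<lambda>r. r * (\<Sum>n<N. u n * r ^ (2 * n)) \<le> B) (at_left 1)"
    proof eventually_elim
      fix r :: real assume r: "r \<in> {0<..<1}"
      have "(\<Sum>n<N. u n * r ^ (2 * n)) \<le> P r"
        using P[of r] u r by (subst sums_unique[of _ "P r"]) (auto intro!: sum_le_suminf sums_summable)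
      then have "r * (\<Sum>n<N. u n * r ^ (2 * n)) \<le> r * P r"
        using r by (intro mult_left_mono) auto
      also have "\<dots> \<le> B" using bd r by simp
      finally show "r * (\<Sum>n<N. u n * r ^ (2 * n)) \<le> B" .
    qed
  qed (simp add: trivial_limit_at_left_real)
  show "summable u"
    by (rule summableI_nonneg_bounded[OF u part])
  then show "suminf u \<le> B"
    by (rule suminf_le_const[OF _ part])
qed

section \<open>The Hardy-Smirnov space of a linear fractional Riemann map\<close>

locale lf_riemann_map =
  fixes \<Omega> :: "complex set" and \<tau> \<sigma> :: "complex \<Rightarrow> complex" and a b c d :: complex
  assumes open_\<Omega>: "open \<Omega>"
    and riemann: "riemann_map \<tau> \<Omega>"
    and lf: "linear_fractional_on unit_disc a b c d \<tau>"
    and branch: "deriv_sqrt_branch \<tau> \<sigma>"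
begin

abbreviation H where "H \<equiv> hs_space \<tau> \<Omega>"

abbreviation inn where "inn \<equiv> hs_inner \<tau> \<sigma>"

definition \<Delta> where "\<Delta> = a * d - b * c"

text \<open>The coordinates of \<open>f\<close>: as \<open>V\<close> is unitary, they turn
  \<open>H\<close> into the space of square-summable sequences, where all norms and inner products
  are computed.\<close>

definition V_coeff where "V_coeff f n = maclaurin_coeff (hs_V \<tau> \<sigma> f) n"

lemma \<Delta>_nz: "\<Delta> \<noteq> 0"
  using lf by (simp add: \<Delta>_def linear_fractional_on_def)

lemma \<tau>_eq: "z \<in> unit_disc \<Longrightarrow> \<tau> z = (a * z + b) / (c * z + d)"
  using lf by (simp add: linear_fractional_on_def)

lemma \<tau>_hol: "\<tau> holomorphic_on unit_disc"
  and \<tau>_image: "\<tau> ` unit_disc = \<Omega>"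
  using riemann by (simp_all add: riemann_map_def)

lemma \<sigma>_hol: "\<sigma> holomorphic_on unit_disc"
  and \<sigma>_sq: "z \<in> unit_disc \<Longrightarrow> (\<sigma> z)\<^sup>2 = deriv \<tau> z"
  using branch by (simp_all add: deriv_sqrt_branch_def)

text \<open>\<open>riemann_map\<close> only asserts that an inverse exists; its values on \<Omega>
  are unique, so any choice gives the same map there.\<close>

definition \<rho> where
  "\<rho> = (SOME g. g holomorphic_on \<Omega> \<and> (\<forall>z\<in>unit_disc. g (\<tau> z) = z) \<and> (\<forall>w\<in>\<Omega>. \<tau> (g w) = w))"

lemma \<rho>_hol: "\<rho> holomorphic_on \<Omega>"
  and \<rho>_\<tau>: "z \<in> unit_disc \<Longrightarrow> \<rho> (\<tau> z) = z"
  and \<tau>_\<rho>: "w \<in> \<Omega> \<Longrightarrow> \<tau> (\<rho> w) = w"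
proof -
  have "\<exists>g. g holomorphic_on \<Omega> \<and> (\<forall>z\<in>unit_disc. g (\<tau> z) = z) \<and> (\<forall>w\<in>\<Omega>. \<tau> (g w) = w)"
    using riemann by (simp add: riemann_map_def)
  from someI_ex[OF this, folded \<rho>_def]
  have "\<rho> holomorphic_on \<Omega> \<and> (\<forall>z\<in>unit_disc. \<rho> (\<tau> z) = z) \<and> (\<forall>w\<in>\<Omega>. \<tau> (\<rho> w) = w)" .
  then show "\<rho> holomorphic_on \<Omega>" "z \<in> unit_disc \<Longrightarrow> \<rho> (\<tau> z) = z" "w \<in> \<Omega> \<Longrightarrow> \<tau> (\<rho> w) = w"
    by blast+
qed

lemma \<tau>_in: "z \<in> unit_disc \<Longrightarrow> \<tau> z \<in> \<Omega>"
  using \<tau>_image by blast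

lemma \<rho>_in: "w \<in> \<Omega> \<Longrightarrow> \<rho> w \<in> unit_disc"
  using \<rho>_\<tau> unfolding \<tau>_image[symmetric] by force

text \<open>Near a zero \<open>z\<close> of the denominator,
  \<open>\<tau> x * (c * x + d) = a * x + b\<close> holds for \<open>x\<close> other than
  \<open>z\<close>, hence by continuity at \<open>z\<close>. So the numerator vanishes at
  \<open>z\<close> too, which would make the determinant 0.\<close>

lemma denom_nz:
  assumes z: "z \<in> unit_disc"
  shows "c * z + d \<noteq> 0"
proof
  assume 0: "c * z + d = 0"
  have c: "c \<noteq> 0" using 0 \<Delta>_nz by (auto simp: \<Delta>_def)
  have "((\<lambda>x. \<tau> x * (c * x + d) - (a * x + b)) \<longlongrightarrow> \<tau> z * (c * z + d) - (a * z + b)) (at z)"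
    using z holomorphic_on_imp_continuous_on[OF \<tau>_hol]
    by (intro tendsto_intros) (simp add: continuous_on_eq_continuous_at isCont_def)
  moreover have "eventually (\<lambda>x. 0 = \<tau> x * (c * x + d) - (a * x + b)) (at z)"
    using eventually_at_in_open[OF open_ball z]
  proof eventually_elim
    case (elim x)
    have "c * x + d \<noteq> 0"
    proof
      assume "c * x + d = 0"
      with 0 have "c * x = c * z" by (metis add_right_cancel)
      with c elim show False by simp
    qed
    with \<tau>_eq[of x] elim show ?case by simp
  qed
  then have "((\<lambda>x. \<tau> x * (c * x + d) - (a * x + b)) \<longlongrightarrow> 0) (at z)"
    by (rule Lim_transform_eventually[OF tendsto_const])
  ultimately have "\<tau> z * (c * z + d) - (a * z + b) = 0"
    by (rule tendsto_unique[rotated]) simp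
  then have "\<tau> z * (c * z + d) = a * z + b"
    by (simp only: right_minus_eq)
  then have "a * z + b = 0"
    unfolding 0 by (simp only: mult_zero_right)
  with 0 have "b = - (a * z)" "d = - (c * z)"
    by (metis add.commute eq_neg_iff_add_eq_0)+
  then have "a * d - b * c = 0" by simp
  then show False using \<Delta>_nz by (simp add: \<Delta>_def)
qed

lemma deriv_\<tau>:
  assumes z: "z \<in> unit_disc"
  shows "deriv \<tau> z = \<Delta> / (c * z + d)\<^sup>2"
proof (rule DERIV_imp_deriv)
  have "((\<lambda>z. (a * z + b) / (c * z + d)) has_field_derivative \<Delta> / (c * z + d)\<^sup>2) (at z)"
    using denom_nz[OF z]
    by (auto intro!: derivative_eq_intros simp: \<Delta>_def field_simps power2_eq_square)
  then show "(\<tau> has_field_derivative \<Delta> / (c * z + d)\<^sup>2) (at z)"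
    by (rule has_field_derivative_transform_within_open[OF _ open_ball z]) (simp add: \<tau>_eq)
qed

text \<open>The constant value of \<open>\<sigma> z * (c * z + d)\<close>, read off at 0; it is a
  square root of \<Delta>.\<close>

definition \<kappa> where "\<kappa> = \<sigma> 0 * d"

text \<open>The product squares to \<Delta>, so it takes at most two values; being continuous on a
  connected set, it is constant.\<close>

lemma \<sigma>_times_denom:
  assumes z: "z \<in> unit_disc"
  shows "\<sigma> z * (c * z + d) = \<kappa>"
proof -
  let ?h = "\<lambda>z. \<sigma> z * (c * z + d)"
  have sq: "(?h z)\<^sup>2 = \<Delta>" if "z \<in> unit_disc" for z
    using \<sigma>_sq[OF that] deriv_\<tau>[OF that] denom_nz[OF that] by (simp add: power_mult_distrib)
  have "?h ` unit_disc \<subseteq> {csqrt \<Delta>, - csqrt \<Delta>}"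
  proof
    fix y assume "y \<in> ?h ` unit_disc"
    with sq have "y\<^sup>2 = (csqrt \<Delta>)\<^sup>2" by auto
    then show "y \<in> {csqrt \<Delta>, - csqrt \<Delta>}" unfolding power2_eq_iff by simp
  qed
  then have "finite (?h ` unit_disc)" by (rule finite_subset) simp
  moreover have "continuous_on unit_disc ?h"
    by (intro continuous_intros holomorphic_on_imp_continuous_on \<sigma>_hol)
  ultimately have "?h constant_on unit_disc"
    by (intro continuous_finite_range_constant connected_ball)
  then obtain y where "\<And>x. x \<in> unit_disc \<Longrightarrow> ?h x = y"
    unfolding constant_on_def by blast
  from this[OF z] this[of 0] show ?thesis by (simp add: \<kappa>_def)
qed

lemma \<kappa>_sq: "\<kappa>\<^sup>2 = \<Delta>"
proof -
  have "\<Delta> = (\<sigma> 0 * d)\<^sup>2"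
    using \<sigma>_sq[of 0] deriv_\<tau>[of 0] denom_nz[of 0] by (simp add: power_mult_distrib)
  then show ?thesis by (simp add: \<kappa>_def)
qed

lemma \<kappa>_nz: "\<kappa> \<noteq> 0"
  using \<kappa>_sq \<Delta>_nz by auto

lemma \<sigma>_eq: "z \<in> unit_disc \<Longrightarrow> \<sigma> z = \<kappa> / (c * z + d)"
  using \<sigma>_times_denom[of z] denom_nz[of z] by (simp add: nonzero_eq_divide_eq)

lemma \<sigma>_nz: "z \<in> unit_disc \<Longrightarrow> \<sigma> z \<noteq> 0"
  using \<sigma>_times_denom[of z] \<kappa>_nz by auto

section \<open>Norm and inner product in terms of the coefficients of \<open>V f\<close>\<close>

lemma hs_V_hol:
  assumes "f holomorphic_on \<Omega>"
  shows "hs_V \<tau> \<sigma> f holomorphic_on unit_disc"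
proof -
  have "(f \<circ> \<tau>) holomorphic_on unit_disc"
    using \<tau>_hol assms \<tau>_image by (intro holomorphic_on_compose_gen) auto
  then show ?thesis
    unfolding hs_V_def using \<sigma>_hol by (auto intro!: holomorphic_intros simp: o_def)
qed

text \<open>By the chain rule the image curve has speed \<open>2 * pi * r\<close> times the squared
  modulus of \<sigma>. This weight is absorbed into \<open>hs_V\<close>, and after division by
  \<open>2 * pi\<close> only \<open>r\<close> is left.\<close>

lemma hs_mean_eq:
  assumes r: "0 < r" "r < 1"
  shows "hs_mean \<tau> f r = r * integral {0..1} (\<lambda>t. (cmod (hs_V \<tau> \<sigma> f (circlepath 0 r t)))\<^sup>2)"
proof -
  have "(cmod (f ((\<tau> \<circ> circlepath 0 r) t)))\<^sup>2 * norm (vector_derivative (\<tau> \<circ> circlepath 0 r) (at t))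
       = 2 * pi * r * (cmod (hs_V \<tau> \<sigma> f (circlepath 0 r t)))\<^sup>2" for t
  proof -
    have z: "circlepath 0 r t \<in> unit_disc"
      using r by (auto simp: circlepath norm_mult)
    have "vector_derivative (\<tau> \<circ> circlepath 0 r) (at t)
        = vector_derivative (circlepath 0 r) (at t) * (\<sigma> (circlepath 0 r t))\<^sup>2"
      unfolding \<sigma>_sq[OF z]
    proof (rule vector_derivative_chain_at_general)
      show "circlepath 0 r differentiable at t"
        by (metis circlepath_def differentiable_part_circlepath)
      show "\<tau> field_differentiable at (circlepath 0 r t)"
        using holomorphic_on_imp_differentiable_at[OF \<tau>_hol open_ball z] .
    qed
    also have "norm \<dots> = 2 * pi * r * (cmod (\<sigma> (circlepath 0 r t)))\<^sup>2"
      using r by (subst vector_derivative_circlepath) (simp add: norm_mult norm_power)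
    finally show ?thesis
      by (simp add: hs_V_def norm_mult power_mult_distrib)
  qed
  then show ?thesis
    by (simp add: hs_mean_def arclength_integral_def)
qed

lemma hs_mean_sums:
  assumes f: "f holomorphic_on \<Omega>" and r: "0 < r" "r < 1"
  shows "(\<lambda>n. (cmod (V_coeff f n))\<^sup>2 * r ^ (2 * n)) sums (hs_mean \<tau> f r / r)"
  using parseval_circle[OF hs_V_hol[OF f] r] r by (simp add: hs_mean_eq V_coeff_def)

text \<open>The means are \<open>r\<close> times Abel sums of the squared coefficients, so the two
  Abel estimates translate boundedness of the means into square summability.\<close>

lemma hs_space_iff:
  "f \<in> H \<longleftrightarrow> f holomorphic_on \<Omega> \<and> summable (\<lambda>n. (cmod (V_coeff f n))\<^sup>2)"
proof (cases "f holomorphic_on \<Omega>")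
  case True
  note sums = hs_mean_sums[OF True]
  have "bdd_above (hs_mean \<tau> f ` {0<..<1}) \<longleftrightarrow> summable (\<lambda>n. (cmod (V_coeff f n))\<^sup>2)"
  proof
    assume "bdd_above (hs_mean \<tau> f ` {0<..<1})"
    then obtain B where B: "\<And>r. 0 < r \<Longrightarrow> r < 1 \<Longrightarrow> hs_mean \<tau> f r \<le> B"
      unfolding bdd_above_def by force
    then show "summable (\<lambda>n. (cmod (V_coeff f n))\<^sup>2)"
      by (intro abel_mean_bounded(1)[OF _ sums, of B]) auto
  next
    assume s: "summable (\<lambda>n. (cmod (V_coeff f n))\<^sup>2)"
    show "bdd_above (hs_mean \<tau> f ` {0<..<1})"
      using abel_mean_le_suminf[OF _ s _ _ sums]
      by (intro bdd_aboveI2[of _ _ "\<Sum>n. (cmod (V_coeff f n))\<^sup>2"]) auto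
  qed
  then show ?thesis using True by (simp add: hs_space_def)
qed (simp add: hs_space_def)

text \<open>Reconciles the norm, a supremum of means, with the inner product, a series in the
  coefficients. This is what makes Cauchy-Schwarz available for \<open>hs_norm\<close>.\<close>

lemma hs_norm_eq:
  assumes "f \<in> H"
  shows "hs_norm \<tau> f = sqrt (\<Sum>n. (cmod (V_coeff f n))\<^sup>2)"
proof -
  have f: "f holomorphic_on \<Omega>" and s: "summable (\<lambda>n. (cmod (V_coeff f n))\<^sup>2)"
    using assms hs_space_iff by auto
  note sums = hs_mean_sums[OF f]
  have bdd: "bdd_above (hs_mean \<tau> f ` {0<..<1})"
    using assms by (simp add: hs_space_def)
  have "(SUP r\<in>{0<..<1}. hs_mean \<tau> f r) = (\<Sum>n. (cmod (V_coeff f n))\<^sup>2)"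
  proof (rule antisym)
    show "(SUP r\<in>{0<..<1}. hs_mean \<tau> f r) \<le> (\<Sum>n. (cmod (V_coeff f n))\<^sup>2)"
      using abel_mean_le_suminf[OF _ s _ _ sums] by (intro cSUP_least) auto
    show "(\<Sum>n. (cmod (V_coeff f n))\<^sup>2) \<le> (SUP r\<in>{0<..<1}. hs_mean \<tau> f r)"
      by (rule abel_mean_bounded(2)[OF _ sums]) (auto intro!: cSUP_upper bdd)
  qed
  then show ?thesis by (simp add: hs_norm_def)
qed

lemma hs_inner_eq: "inn f g = (\<Sum>n. V_coeff f n * cnj (V_coeff g n))"
  by (simp add: hs_inner_def hardy_inner_def V_coeff_def)

lemma V_coeff_eqI:
  assumes "\<And>z. z \<in> unit_disc \<Longrightarrow> (\<lambda>n. u n * z ^ n) sums (f (\<tau> z) * \<sigma> z)"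
  shows "V_coeff f n = u n"
  unfolding V_coeff_def hs_V_def by (rule maclaurin_coeff_unique[OF assms])

lemma V_coeff_sums:
  assumes "f holomorphic_on \<Omega>" "z \<in> unit_disc"
  shows "(\<lambda>n. V_coeff f n * z ^ n) sums (f (\<tau> z) * \<sigma> z)"
  using maclaurin_coeff_sums[OF hs_V_hol[OF assms(1)] assms(2)]
  by (simp add: V_coeff_def hs_V_def)

lemma V_coeff_lincomb:
  assumes "f holomorphic_on \<Omega>" "g holomorphic_on \<Omega>"
  shows "V_coeff (\<lambda>x. \<alpha> * f x + \<beta> * g x) n = \<alpha> * V_coeff f n + \<beta> * V_coeff g n"
  using maclaurin_coeff_lincomb[OF hs_V_hol[OF assms(1)] hs_V_hol[OF assms(2)], of \<alpha> \<beta> n]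
  by (simp add: V_coeff_def hs_V_def algebra_simps)

lemma hs_space_hol: "f \<in> H \<Longrightarrow> f holomorphic_on \<Omega>"
  by (simp add: hs_space_iff)

lemma hs_space_summable: "f \<in> H \<Longrightarrow> summable (\<lambda>n. (cmod (V_coeff f n))\<^sup>2)"
  by (simp add: hs_space_iff)

lemma hs_space_lincomb:
  assumes f: "f \<in> H" and g: "g \<in> H"
  shows "(\<lambda>x. \<alpha> * f x + \<beta> * g x) \<in> H"
  unfolding hs_space_iff
proof
  note hol = hs_space_hol[OF f] hs_space_hol[OF g]
  show "(\<lambda>x. \<alpha> * f x + \<beta> * g x) holomorphic_on \<Omega>"
    by (intro holomorphic_intros hol)
  have sum: "summable (\<lambda>n. 2 * ((cmod \<alpha>)\<^sup>2 * (cmod (V_coeff f n))\<^sup>2 + (cmod \<beta>)\<^sup>2 * (cmod (V_coeff g n))\<^sup>2))"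
    by (intro summable_mult summable_add hs_space_summable f g)
  show "summable (\<lambda>n. (cmod (V_coeff (\<lambda>x. \<alpha> * f x + \<beta> * g x) n))\<^sup>2)"
  proof (rule summable_comparison_test'[OF sum])
    fix n
    let ?x = "\<alpha> * V_coeff f n" and ?y = "\<beta> * V_coeff g n"
    have "(cmod (?x + ?y))\<^sup>2 \<le> (cmod ?x + cmod ?y)\<^sup>2"
      by (intro power_mono norm_triangle_ineq) simp
    also have "\<dots> \<le> 2 * ((cmod ?x)\<^sup>2 + (cmod ?y)\<^sup>2)"
      using sum_squares_bound[of "cmod ?x" "cmod ?y"] by (simp add: power2_sum)
    finally show "norm ((cmod (V_coeff (\<lambda>x. \<alpha> * f x + \<beta> * g x) n))\<^sup>2)
        \<le> 2 * ((cmod \<alpha>)\<^sup>2 * (cmod (V_coeff f n))\<^sup>2 + (cmod \<beta>)\<^sup>2 * (cmod (V_coeff g n))\<^sup>2)"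
      by (simp add: V_coeff_lincomb[OF hol] norm_mult power_mult_distrib)
  qed
qed

lemma hs_inner_sums:
  assumes "f \<in> H" "g \<in> H"
  shows "(\<lambda>n. V_coeff f n * cnj (V_coeff g n)) sums inn f g"
  unfolding hs_inner_eq using assms
  by (intro summable_sums summable_norm_cancel[OF l2_summable_mult] hs_space_summable)

lemma hs_inner_commute:
  assumes "f \<in> H" "g \<in> H"
  shows "inn g f = cnj (inn f g)"
  using hs_inner_sums[OF assms(2,1)] hs_inner_sums[OF assms]
  by (subst (asm) (2) sums_cnj[symmetric]) (simp add: sums_iff mult.commute)

lemma hs_inner_lincomb_left:
  assumes "f \<in> H" "g \<in> H" "h \<in> H"
  shows "inn (\<lambda>x. \<alpha> * f x + \<beta> * g x) h = \<alpha> * inn f h + \<beta> * inn g h"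
proof -
  have "(\<lambda>n. \<alpha> * (V_coeff f n * cnj (V_coeff h n)) + \<beta> * (V_coeff g n * cnj (V_coeff h n)))
          sums (\<alpha> * inn f h + \<beta> * inn g h)"
    by (intro sums_add sums_mult hs_inner_sums assms)
  then have "(\<lambda>n. V_coeff (\<lambda>x. \<alpha> * f x + \<beta> * g x) n * cnj (V_coeff h n))
          sums (\<alpha> * inn f h + \<beta> * inn g h)"
    using assms by (simp add: V_coeff_lincomb hs_space_hol algebra_simps)
  then show ?thesis
    using hs_inner_sums[OF hs_space_lincomb[OF assms(1,2)] assms(3)] by (metis sums_unique2)
qed

lemma hs_inner_bound:
  assumes "f \<in> H" "g \<in> H"
  shows "cmod (inn f g) \<le> hs_norm \<tau> f * hs_norm \<tau> g"
  using assms by (simp add: hs_inner_eq hs_norm_eq l2_Cauchy_Schwarz hs_space_summable)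

lemma hs_norm_nonneg: "f \<in> H \<Longrightarrow> 0 \<le> hs_norm \<tau> f"
  by (simp add: hs_norm_eq suminf_nonneg hs_space_summable)

text \<open>The preimage of \<open>z ^ n\<close> under \<open>V\<close>.\<close>

definition basis where "basis n w = \<rho> w ^ n / \<sigma> (\<rho> w)"

lemma basis_hol: "basis n holomorphic_on \<Omega>"
proof -
  have "(\<sigma> \<circ> \<rho>) holomorphic_on \<Omega>"
    using \<rho>_in by (intro holomorphic_on_compose_gen[OF \<rho>_hol \<sigma>_hol]) auto
  then have "(\<lambda>w. \<rho> w ^ n / \<sigma> (\<rho> w)) holomorphic_on \<Omega>"
    using \<sigma>_nz \<rho>_in by (intro holomorphic_intros \<rho>_hol) (auto simp: o_def)
  then show ?thesis by (simp add: basis_def[abs_def])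
qed

lemma V_coeff_basis: "V_coeff (basis n) m = (if m = n then 1 else 0)"
proof (rule V_coeff_eqI)
  fix z :: complex assume "z \<in> unit_disc"
  moreover have "(\<lambda>m. (if m = n then 1 else 0) * z ^ m) = (\<lambda>m. if m = n then z ^ m else 0)"
    by auto
  ultimately show "(\<lambda>m. (if m = n then 1 else 0) * z ^ m) sums (basis n (\<tau> z) * \<sigma> z)"
    using sums_single[of n "\<lambda>m. z ^ m"] by (simp add: basis_def \<rho>_\<tau> \<sigma>_nz)
qed

lemma basis_in: "basis n \<in> H"
proof -
  have "summable (\<lambda>m. (cmod (V_coeff (basis n) m))\<^sup>2)"
    by (rule summable_finite[of "{n}"]) (simp_all add: V_coeff_basis)
  then show ?thesis by (simp add: hs_space_iff basis_hol)
qed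

section \<open>The reproducing kernel\<close>

text \<open>The inverse of \<tau> is \<open>(d * w - b) / (a - c * w)\<close>, so
  \<open>D v w\<close> is \<open>1 - \<rho> v * cnj (\<rho> w)\<close> cleared of
  denominators.\<close>

definition D where "D v w = (a - c * v) * cnj (a - c * w) - (d * v - b) * cnj (d * w - b)"

text \<open>The Szego kernel of the disc, transported to \<Omega>. The base point comes first and
  the variable second, opposite to the order in \<open>D\<close>.\<close>

definition kern where "kern w v = cmod \<Delta> / D v w"

lemma D_\<tau>:
  assumes z: "z \<in> unit_disc" and x: "x \<in> unit_disc"
  shows "D (\<tau> x) (\<tau> z) = (cmod \<Delta>)\<^sup>2 * (1 - x * cnj z) / ((c * x + d) * cnj (c * z + d))"
proof -
  have *: "a - c * \<tau> y = \<Delta> / (c * y + d)" "d * \<tau> y - b = \<Delta> * y / (c * y + d)"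
    if "y \<in> unit_disc" for y
    using denom_nz[OF that] by (simp_all add: \<tau>_eq[OF that] \<Delta>_def field_simps)
  show ?thesis
    unfolding D_def *[OF z] *[OF x] using denom_nz[OF z] denom_nz[OF x]
    by (simp add: complex_norm_square diff_divide_distrib algebra_simps del: of_real_power)
qed

lemma one_minus_mult_cnj_nz:
  assumes "z \<in> unit_disc" "x \<in> unit_disc"
  shows "cmod (x * cnj z) < 1" "1 - x * cnj z \<noteq> 0"
proof -
  show "cmod (x * cnj z) < 1"
    using assms mult_strict_mono'[of "cmod x" 1 "cmod z" 1] by (simp add: norm_mult)
  then show "1 - x * cnj z \<noteq> 0" by auto
qed

lemma D_nz:
  assumes "v \<in> \<Omega>" "w \<in> \<Omega>"
  shows "D v w \<noteq> 0"
proof -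
  note \<rho> = \<rho>_in[OF assms(1)] \<rho>_in[OF assms(2)]
  have "D (\<tau> (\<rho> v)) (\<tau> (\<rho> w)) \<noteq> 0"
    unfolding D_\<tau>[OF \<rho>(2,1)] divide_eq_0_iff mult_eq_0_iff complex_cnj_zero_iff
    using \<Delta>_nz denom_nz[OF \<rho>(1)] denom_nz[OF \<rho>(2)] one_minus_mult_cnj_nz(2)[OF \<rho>(2,1)] by simp
  then show ?thesis using assms by (simp add: \<tau>_\<rho>)
qed

lemma kern_hol:
  assumes "w \<in> \<Omega>"
  shows "kern w holomorphic_on \<Omega>"
proof -
  have "(\<lambda>v. cmod \<Delta> / ((a - c * v) * cnj (a - c * w) - (d * v - b) * cnj (d * w - b))) holomorphic_on \<Omega>"
    by (intro holomorphic_intros) (use D_nz assms in \<open>auto simp: D_def\<close>)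
  then show ?thesis by (simp add: kern_def[abs_def] D_def)
qed

text \<open>Since \<open>cmod \<Delta> = \<kappa> * cnj \<kappa>\<close> and
  \<open>\<sigma> x = \<kappa> / (c * x + d)\<close>, the constants cancel and only the Szego kernel
  over \<open>cnj (\<sigma> z)\<close> remains.\<close>

lemma kern_\<tau>:
  assumes z: "z \<in> unit_disc" and x: "x \<in> unit_disc"
  shows "kern (\<tau> z) (\<tau> x) * \<sigma> x = 1 / (cnj (\<sigma> z) * (1 - x * cnj z))"
proof -
  have "complex_of_real (cmod \<Delta>) = \<kappa> * cnj \<kappa>"
    using \<kappa>_sq by (metis norm_power complex_norm_square)
  then show ?thesis
    using denom_nz[OF z] denom_nz[OF x] one_minus_mult_cnj_nz(2)[OF z x] \<kappa>_nz
    unfolding kern_def D_\<tau>[OF z x] \<sigma>_eq[OF z] \<sigma>_eq[OF x]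
    by (simp add: power2_eq_square)
qed

lemma V_coeff_kern:
  assumes z: "z \<in> unit_disc"
  shows "V_coeff (kern (\<tau> z)) n = cnj z ^ n / cnj (\<sigma> z)"
proof (rule V_coeff_eqI)
  fix x :: complex assume x: "x \<in> unit_disc"
  have "(\<lambda>n. (x * cnj z) ^ n / cnj (\<sigma> z)) sums (1 / (1 - x * cnj z) / cnj (\<sigma> z))"
    using one_minus_mult_cnj_nz(1)[OF z x] by (intro sums_divide geometric_sums)
  then show "(\<lambda>n. cnj z ^ n / cnj (\<sigma> z) * x ^ n) sums (kern (\<tau> z) (\<tau> x) * \<sigma> x)"
    unfolding kern_\<tau>[OF z x] by (simp add: power_mult_distrib mult_ac)
qed

lemma kern_in:
  assumes "w \<in> \<Omega>"
  shows "kern w \<in> H"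
proof -
  define z where "z = \<rho> w"
  have z: "z \<in> unit_disc" and w: "w = \<tau> z"
    using assms by (simp_all only: z_def \<rho>_in \<tau>_\<rho>)
  have "(cmod z)\<^sup>2 < 1"
    using z by (simp add: power_less_one_iff)
  then have "summable (\<lambda>n. ((cmod z)\<^sup>2) ^ n / (cmod (\<sigma> z))\<^sup>2)"
    by (intro summable_divide summable_geometric) simp
  then show ?thesis
    using kern_hol[OF assms] unfolding hs_space_iff w
    by (simp add: V_coeff_kern[OF z] norm_divide norm_power power_divide power_commutes flip: power_mult)
      (simp add: mult.commute)
qed

text \<open>Pairing with the kernel coefficients sums the power series of \<open>V f\<close> at
  \<open>z\<close>; their denominator then removes the weight \<open>\<sigma> z\<close>.\<close>

lemma reproducing:
  assumes f: "f \<in> H" and w: "w \<in> \<Omega>"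
  shows "inn f (kern w) = f w"
proof -
  define z where "z = \<rho> w"
  have z: "z \<in> unit_disc" and w': "w = \<tau> z"
    using w by (simp_all only: z_def \<rho>_in \<tau>_\<rho>)
  have "(\<lambda>n. V_coeff f n * z ^ n / \<sigma> z) sums (f (\<tau> z) * \<sigma> z / \<sigma> z)"
    by (intro sums_divide V_coeff_sums hs_space_hol f z)
  then have "(\<lambda>n. V_coeff f n * cnj (V_coeff (kern w) n)) sums f w"
    using \<sigma>_nz[OF z] by (simp add: w' V_coeff_kern[OF z])
  then show ?thesis
    unfolding hs_inner_eq by (simp add: sums_iff)
qed

section \<open>Bounded functionals\<close>

text \<open>Linearity splits off finitely many basis terms, and boundedness controls the remainder,
  whose norm is the square root of a tail of a convergent series.\<close>

lemma functional_basis_expansion: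
  assumes lin: "\<And>f g \<alpha> \<beta>. f \<in> H \<Longrightarrow> g \<in> H \<Longrightarrow> L (\<lambda>x. \<alpha> * f x + \<beta> * g x) = \<alpha> * L f + \<beta> * L g"
    and bd: "\<And>f. f \<in> H \<Longrightarrow> cmod (L f) \<le> B * hs_norm \<tau> f"
    and g: "g \<in> H"
  shows "(\<lambda>n. V_coeff g n * L (basis n)) sums L g"
proof -
  \<comment> \<open>the remainder \<open>g - (\<Sum>n<N. V_coeff g n * basis n)\<close>, shaped so that \<open>lin\<close> applies\<close>
  define R where "R = rec_nat g (\<lambda>N h x. 1 * h x + (- V_coeff g N) * basis N x)"
  have R0: "R 0 = g" and RS: "R (Suc N) = (\<lambda>x. 1 * R N x + (- V_coeff g N) * basis N x)" for N
    by (simp_all add: R_def)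
  have RH: "R N \<in> H" for N
    by (induction N) (simp_all only: R0 RS g hs_space_lincomb basis_in)
  have coeff_R: "V_coeff (R N) n = (if n < N then 0 else V_coeff g n)" for N n
  proof (induction N)
    case (Suc N)
    then show ?case
      unfolding RS V_coeff_lincomb[OF hs_space_hol[OF RH] basis_hol] by (auto simp: V_coeff_basis less_Suc_eq)
  qed (simp add: R0)
  have L_R: "L (R N) = L g - (\<Sum>n<N. V_coeff g n * L (basis n))" for N
    by (induction N) (simp_all only: R0 RS lin[OF RH basis_in], simp_all)
  define s where "s n = (cmod (V_coeff g n))\<^sup>2" for n
  have s: "summable s"
    using hs_space_summable[OF g] by (simp add: s_def[abs_def])
  have "hs_norm \<tau> (R N) = sqrt (\<Sum>n. s (n + N))" for N
  proof -
    have "(\<Sum>n. (cmod (V_coeff (R N) n))\<^sup>2) = (\<Sum>n. (cmod (V_coeff (R N) (n + N)))\<^sup>2)"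
      by (subst suminf_split_initial_segment[OF hs_space_summable[OF RH], of _ N]) (simp add: coeff_R)
    then show ?thesis by (simp add: hs_norm_eq[OF RH] coeff_R s_def)
  qed
  moreover have "(\<lambda>N. \<Sum>n. s (n + N)) \<longlonglongrightarrow> 0"
  proof -
    have "(\<lambda>N. suminf s - (\<Sum>n<N. s n)) \<longlonglongrightarrow> suminf s - suminf s"
      by (intro tendsto_intros summable_LIMSEQ s)
    then show ?thesis by (simp add: suminf_minus_initial_segment[OF s])
  qed
  ultimately have "(\<lambda>N. hs_norm \<tau> (R N)) \<longlonglongrightarrow> sqrt 0"
    by (simp only:) (intro tendsto_intros)
  then have "(\<lambda>N. B * hs_norm \<tau> (R N)) \<longlonglongrightarrow> 0"
    by (intro tendsto_mult_right_zero) simp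
  then have "(\<lambda>N. L (R N)) \<longlonglongrightarrow> 0"
    by (rule Lim_null_comparison[rotated]) (simp add: bd RH)
  then have "(\<lambda>N. L g - L (R N)) \<longlonglongrightarrow> L g - 0"
    by (intro tendsto_intros)
  then show ?thesis by (simp add: sums_def L_R)
qed

text \<open>Density of the span of the kernels, phrased for functionals so that neither closures nor
  orthogonal complements enter.\<close>

lemma functional_eq_0:
  assumes lin: "\<And>f g \<alpha> \<beta>. f \<in> H \<Longrightarrow> g \<in> H \<Longrightarrow> L (\<lambda>x. \<alpha> * f x + \<beta> * g x) = \<alpha> * L f + \<beta> * L g"
    and bd: "\<And>f. f \<in> H \<Longrightarrow> cmod (L f) \<le> B * hs_norm \<tau> f"
    and kern: "\<And>w. w \<in> \<Omega> \<Longrightarrow> L (kern w) = 0"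
    and g: "g \<in> H"
  shows "L g = 0"
proof -
  have ex: "(\<lambda>n. V_coeff f n * L (basis n)) sums L f" if "f \<in> H" for f
    using lin bd that by (rule functional_basis_expansion)
  have "(\<lambda>n. L (basis n) * x ^ n) sums 0" if x: "x \<in> unit_disc" for x
  proof -
    \<comment> \<open>Kernel coefficients are powers of the conjugated base point, so basing the
      kernel at \<open>\<tau> (cnj x)\<close> produces a power series in \<open>x\<close>
      itself.\<close>
    have z: "cnj x \<in> unit_disc" using x by simp
    have "(\<lambda>n. cnj (\<sigma> (cnj x)) * (V_coeff (kern (\<tau> (cnj x))) n * L (basis n))) sums (cnj (\<sigma> (cnj x)) * 0)"
      using ex[OF kern_in[OF \<tau>_in[OF z]]] kern[OF \<tau>_in[OF z]] by (intro sums_mult) simp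
    then show ?thesis
      using \<sigma>_nz[OF z] by (simp add: V_coeff_kern[OF z] mult.commute)
  qed
  then have "maclaurin_coeff (\<lambda>_. 0) n = L (basis n)" for n
    by (rule maclaurin_coeff_unique)
  moreover have "maclaurin_coeff (\<lambda>_. 0) n = 0" for n
    by (rule maclaurin_coeff_unique) simp
  ultimately have "L (basis n) = 0" for n by metis
  with ex[OF g] show ?thesis by (simp add: sums_iff)
qed

section \<open>The expansion of \<open>D\<close> and its coefficients\<close>

definition q where "q = b * cnj d - a * cnj c"

text \<open>The coefficient of \<open>v * cnj w\<close> in \<open>D\<close>. It vanishes exactly
  when the pole of \<tau> lies on the unit circle, that is, when \<Omega> is a half-plane; otherwise
  \<Omega> is a disc with centre \<open>- q / s\<close>.\<close>

definition s where "s = (cmod c)\<^sup>2 - (cmod d)\<^sup>2"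

lemma D_expand:
  "D v w = of_real ((cmod a)\<^sup>2 - (cmod b)\<^sup>2) + (cnj q * v + q * cnj w + of_real s * v * cnj w)"
  by (simp add: D_def q_def s_def complex_norm_square algebra_simps del: of_real_power)

lemma D_eq_iff:
  "D v w = D v' w' \<longleftrightarrow> cnj q * v + q * cnj w + of_real s * v * cnj w
     = cnj q * v' + q * cnj w' + of_real s * v' * cnj w'"
  unfolding D_expand by (rule add_left_cancel)

text \<open>For \<open>s = 0\<close> one has \<open>cnj c * \<Delta> = - d * q\<close> with
  \<open>c\<close> nonzero. The lemma permits cancelling \<open>cnj q\<close> in the translation
  case.\<close>

lemma q_nz:
  assumes "s = 0"
  shows "q \<noteq> 0"
proof
  assume "q = 0"
  have cd: "c * cnj c = d * cnj d"
    using assms by (simp add: s_def flip: complex_norm_square)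
  have d: "d \<noteq> 0"
  proof
    assume "d = 0"
    with cd have "c = 0" by simp
    then have "a * d - b * c = 0" using \<open>d = 0\<close> by simp
    then show False using \<Delta>_nz by (simp add: \<Delta>_def)
  qed
  then have c: "cnj c \<noteq> 0" using cd by auto
  have "cnj c * (a * d - b * c) = a * cnj c * d - b * (c * cnj c)"
    by (simp add: algebra_simps)
  also have "\<dots> = - d * q"
    unfolding cd q_def by (simp add: algebra_simps)
  finally show False using \<open>q = 0\<close> c \<Delta>_nz by (simp add: \<Delta>_def)
qed

lemma kern_eq_iff:
  assumes "v \<in> \<Omega>" "w \<in> \<Omega>" "v' \<in> \<Omega>" "w' \<in> \<Omega>"
  shows "kern w v = kern w' v' \<longleftrightarrow> D v w = D v' w'"
  using \<Delta>_nz D_nz[of v w] D_nz[of v' w'] assms by (auto simp: kern_def field_simps)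

lemma kern_commute: "cnj (kern w v) = kern v w"
  by (simp add: kern_def D_def algebra_simps)

section \<open>Hermitian composition operators\<close>

text \<open>The inner product of \<open>?C (kern w)\<close> with \<open>kern v\<close> is evaluated
  twice by the reproducing property, directly and after moving the operator to the other
  side.\<close>

lemma hermitian_imp_D:
  assumes self: "\<Phi> ` \<Omega> \<subseteq> \<Omega>" and herm: "hs_hermitian \<tau> \<sigma> \<Omega> (composition_operator \<Phi>)"
    and v: "v \<in> \<Omega>" and w: "w \<in> \<Omega>"
  shows "D (\<Phi> v) w = D v (\<Phi> w)"
proof -
  let ?C = "composition_operator \<Phi>"
  have CH: "?C f \<in> H" if "f \<in> H" for f
    using herm that by (simp add: hs_hermitian_def hs_bounded_operator_def)
  note kv = kern_in[OF v] and kw = kern_in[OF w]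
  have "kern w (\<Phi> v) = inn (?C (kern w)) (kern v)"
    by (simp add: reproducing CH kw v) (simp add: composition_operator_def)
  also have "\<dots> = inn (kern w) (?C (kern v))"
    using herm kv kw by (simp add: hs_hermitian_def hs_adjoint_def)
  also have "\<dots> = cnj (inn (?C (kern v)) (kern w))"
    by (intro hs_inner_commute CH kv kw)
  also have "\<dots> = kern (\<Phi> w) v"
    by (simp add: reproducing CH kv w) (simp add: composition_operator_def kern_commute)
  finally show ?thesis
    using self v w by (subst (asm) kern_eq_iff) auto
qed

lemma D_imp_hermitian:
  assumes self: "\<Phi> ` \<Omega> \<subseteq> \<Omega>" and bdd: "hs_bounded_operator \<tau> \<Omega> (composition_operator \<Phi>)"
    and eq: "\<And>v w. v \<in> \<Omega> \<Longrightarrow> w \<in> \<Omega> \<Longrightarrow> D (\<Phi> v) w = D v (\<Phi> w)"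
  shows "hs_hermitian \<tau> \<sigma> \<Omega> (composition_operator \<Phi>)"
proof -
  let ?C = "composition_operator \<Phi>"
  obtain M where CH: "\<And>f. f \<in> H \<Longrightarrow> ?C f \<in> H"
    and M: "\<And>f. f \<in> H \<Longrightarrow> hs_norm \<tau> (?C f) \<le> M * hs_norm \<tau> f"
    using bdd unfolding hs_bounded_operator_def by blast
  have C_lincomb: "?C (\<lambda>x. \<alpha> * f x + \<beta> * g x) = (\<lambda>x. \<alpha> * ?C f x + \<beta> * ?C g x)" for f g \<alpha> \<beta>
    by (simp add: composition_operator_def o_def)
  have "inn (?C g) f = inn g (?C f)" if f: "f \<in> H" and g: "g \<in> H" for f g
  proof -
    define L where "L g = inn (?C g) f - inn g (?C f)" for g
    have "L g = 0"
    proof (rule functional_eq_0[of L, OF _ _ _ g])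
      show "L (\<lambda>x. \<alpha> * h x + \<beta> * k x) = \<alpha> * L h + \<beta> * L k" if "h \<in> H" "k \<in> H" for h k \<alpha> \<beta>
        using that f by (simp add: L_def C_lincomb hs_inner_lincomb_left CH algebra_simps)
      \<comment> \<open>Cauchy-Schwarz bounds both terms of \<open>L h\<close>; the operator bound
        \<open>M\<close> is applied in the first, while \<open>f\<close> is fixed in the
        second.\<close>
      show "cmod (L h) \<le> (M * hs_norm \<tau> f + hs_norm \<tau> (?C f)) * hs_norm \<tau> h" if h: "h \<in> H" for h
      proof -
        have "cmod (L h) \<le> hs_norm \<tau> (?C h) * hs_norm \<tau> f + hs_norm \<tau> h * hs_norm \<tau> (?C f)"
          unfolding L_def using hs_inner_bound[OF CH[OF h] f] hs_inner_bound[OF h CH[OF f]]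
            norm_triangle_ineq4 by (meson add_mono order_trans)
        also have "hs_norm \<tau> (?C h) * hs_norm \<tau> f \<le> M * hs_norm \<tau> h * hs_norm \<tau> f"
          by (intro mult_right_mono M h hs_norm_nonneg f)
        finally show ?thesis by (simp add: algebra_simps)
      qed
      show "L (kern w) = 0" if w: "w \<in> \<Omega>" for w
      proof -
        have \<Phi>w: "\<Phi> w \<in> \<Omega>" using self w by blast
        \<comment> \<open>The equation identifies the two functions on \<Omega> only, not as total
          functions, so they are compared through the coefficients, which determine
          \<open>inn\<close>.\<close>
        have "V_coeff (?C (kern w)) n = V_coeff (kern (\<Phi> w)) n" for n
        proof (rule V_coeff_eqI)
          fix z :: complex assume z: "z \<in> unit_disc"
          have "kern (\<Phi> w) (\<tau> z) = ?C (kern w) (\<tau> z)"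
            using eq[of "\<tau> z" w] w \<tau>_in[OF z] by (simp add: composition_operator_def kern_def)
          then show "(\<lambda>n. V_coeff (kern (\<Phi> w)) n * z ^ n) sums (?C (kern w) (\<tau> z) * \<sigma> z)"
            using V_coeff_sums[OF kern_hol[OF \<Phi>w] z] by simp
        qed
        then have "inn (?C (kern w)) f = inn (kern (\<Phi> w)) f"
          by (simp add: hs_inner_eq)
        also have "\<dots> = cnj (f (\<Phi> w))"
          using hs_inner_commute[OF f kern_in[OF \<Phi>w]] by (simp add: reproducing f \<Phi>w)
        also have "\<dots> = inn (kern w) (?C f)"
          using hs_inner_commute[OF CH[OF f] kern_in[OF w]]
          by (simp add: reproducing f CH w) (simp add: composition_operator_def)
        finally show ?thesis by (simp add: L_def)
      qed
    qed
    then show ?thesis by (simp add: L_def)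
  qed
  then show ?thesis
    using bdd by (simp add: hs_hermitian_def hs_adjoint_def)
qed

section \<open>Solving the functional equation for \<Phi>\<close>

lemma \<Omega>_nonempty: "\<Omega> \<noteq> {}"
  using \<tau>_in[of 0] by auto

text \<open>For \<open>s = 0\<close> the equation separates: one side depends on \<open>v\<close>
  only, the other on \<open>w\<close> only, so \<open>\<Phi> w - w\<close> is constant. The diagonal
  case \<open>v = w\<close> gives the reality condition.\<close>

lemma D_eq_translation:
  assumes eq: "\<And>v w. v \<in> \<Omega> \<Longrightarrow> w \<in> \<Omega> \<Longrightarrow> D (\<Phi> v) w = D v (\<Phi> w)"
    and cd: "s = 0"
  shows "\<exists>r. cnj r * q \<in> \<real> \<and> (\<forall>w\<in>\<Omega>. \<Phi> w = w + r)"
proof -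
  obtain p where p: "p \<in> \<Omega>" using \<Omega>_nonempty by blast
  define r where "r = \<Phi> p - p"
  have *: "cnj q * (\<Phi> v - v) = q * cnj (\<Phi> w - w)" if "v \<in> \<Omega>" "w \<in> \<Omega>" for v w
    using eq[OF that] cd unfolding D_eq_iff by (simp add: algebra_simps)
  have "cnj q * (\<Phi> w - w) = cnj q * r" if "w \<in> \<Omega>" for w
    using *[OF that p] *[OF p p] unfolding r_def by (simp only:)
  then have "\<Phi> w - w = r" if "w \<in> \<Omega>" for w
    using q_nz[OF cd] that by (metis complex_cnj_zero_iff mult_cancel_left)
  moreover have "cnj r * q \<in> \<real>"
    using *[OF p p] by (simp add: Reals_cnj_iff r_def mult.commute)
  ultimately show ?thesis by (intro exI[of _ r]) (auto simp: algebra_simps)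
qed

text \<open>Completing the square gives \<open>D v w = s * (v + e) * cnj (w + e)\<close> plus a
  constant. So \<Phi> multiplies \<open>w + e\<close> by a constant factor, and the diagonal case
  \<open>v = w\<close> makes this factor real.\<close>

lemma D_eq_dilation:
  assumes eq: "\<And>v w. v \<in> \<Omega> \<Longrightarrow> w \<in> \<Omega> \<Longrightarrow> D (\<Phi> v) w = D v (\<Phi> w)"
    and cd: "s \<noteq> 0"
  shows "\<exists>r::real. \<forall>w\<in>\<Omega>. \<Phi> w = of_real r * w + of_real (r - 1) * q / of_real s"
proof -
  define e where "e = q / of_real s"
  have s: "complex_of_real s \<noteq> 0" using cd by simp
  have q: "q = of_real s * e" using s by (simp add: e_def)
  have *: "(\<Phi> v + e) * cnj (w + e) = (v + e) * cnj (\<Phi> w + e)" if "v \<in> \<Omega>" "w \<in> \<Omega>" for v w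
  proof -
    have "of_real s * ((\<Phi> v + e) * cnj (w + e)) = of_real s * ((v + e) * cnj (\<Phi> w + e))"
      using eq[OF that] unfolding D_eq_iff unfolding q by (simp add: algebra_simps)
    then show ?thesis using s by simp
  qed
  \<comment> \<open>The factor is a quotient by \<open>p + e\<close>, so \<open>p\<close> must avoid
    the centre \<open>- e\<close>; a nonempty open set has other points.\<close>
  obtain p where p: "p \<in> \<Omega>" "p + e \<noteq> 0"
  proof -
    obtain p0 where "p0 \<in> \<Omega>" using \<Omega>_nonempty by blast
    then have "infinite \<Omega>" using open_\<Omega> finite_imp_not_open by blast
    then have "\<not> \<Omega> \<subseteq> {- e}" using infinite_super by blast
    then show ?thesis using that by (auto simp: add_eq_0_iff2)
  qed
  define r where "r = (\<Phi> p + e) / (p + e)"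
  have "(\<Phi> p + e) = r * (p + e)" using p by (simp add: r_def)
  have pe: "cnj p + cnj e \<noteq> 0"
    using p(2) by (metis complex_cnj_add complex_cnj_zero_iff)
  with *[OF p(1) p(1)] p(2) \<open>\<Phi> p + e = r * (p + e)\<close> have "r = cnj r"
    by simp
  then obtain r' where r': "r = of_real r'"
    by (metis Reals_cases Reals_cnj_iff)
  have "\<Phi> w = of_real r' * w + of_real (r' - 1) * q / of_real s" if "w \<in> \<Omega>" for w
  proof -
    have "(\<Phi> w + e) * cnj (p + e) = r * (w + e) * cnj (p + e)"
      using *[OF that p(1)] \<open>\<Phi> p + e = r * (p + e)\<close> \<open>r = cnj r\<close> by (simp add: mult.commute)
    then have "\<Phi> w + e = r * (w + e)" using pe by simp
    then have "\<Phi> w = of_real r' * w + of_real (r' - 1) * e"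
      by (simp add: r' algebra_simps)
    then show ?thesis by (simp add: e_def)
  qed
  then show ?thesis by blast
qed

text \<open>The two sides differ only in the constants \<open>cnj q * r\<close> and
  \<open>q * cnj r\<close>, which the reality condition equates.\<close>

lemma translation_D_eq:
  assumes "s = 0" "cnj r * q \<in> \<real>" "\<And>w. w \<in> \<Omega> \<Longrightarrow> \<Phi> w = w + r"
    and "v \<in> \<Omega>" "w \<in> \<Omega>"
  shows "D (\<Phi> v) w = D v (\<Phi> w)"
proof -
  have "cnj q * r = q * cnj r"
    using assms(2) unfolding Reals_cnj_iff by (simp add: mult.commute)
  then show ?thesis
    unfolding D_eq_iff assms(3)[OF assms(4)] assms(3)[OF assms(5)] using assms(1)
    by (simp add: algebra_simps)
qed

text \<open>After completing the square both sides equal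
  \<open>r * s * (v + e) * cnj (w + e)\<close> plus the same constant, because \<open>r\<close> is
  real.\<close>

lemma dilation_D_eq:
  assumes "s \<noteq> 0"
    and \<Phi>: "\<And>w. w \<in> \<Omega> \<Longrightarrow> \<Phi> w = of_real r * w + of_real (r - 1) * q / of_real s"
    and "v \<in> \<Omega>" "w \<in> \<Omega>"
  shows "D (\<Phi> v) w = D v (\<Phi> w)"
proof -
  define e where "e = q / of_real s"
  have s: "complex_of_real s \<noteq> 0" using assms(1) by simp
  have q: "q = of_real s * e" using s by (simp add: e_def)
  have \<Phi>: "\<Phi> x = of_real r * x + of_real (r - 1) * e" if "x \<in> \<Omega>" for x
    using \<Phi>[OF that] by (simp add: e_def)
  show ?thesis
    unfolding D_eq_iff \<Phi>[OF assms(3)] \<Phi>[OF assms(4)] unfolding q by (simp add: algebra_simps)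
qed

end

section \<open>Characterisation of the Hermitian composition operators\<close>

theorem theorem4p5:
  fixes \<Omega> :: "complex set" and \<tau> \<sigma> :: "complex \<Rightarrow> complex" and a b c d :: complex
  assumes "open \<Omega>" and "simply_connected \<Omega>" and "\<Omega> \<noteq> UNIV"
    and "riemann_map \<tau> \<Omega>"
    and "linear_fractional_on unit_disc a b c d \<tau>"
    and "deriv_sqrt_branch \<tau> \<sigma>"
  shows "(\<forall>\<Phi>. \<Phi> holomorphic_on \<Omega> \<and> \<Phi> ` \<Omega> \<subseteq> \<Omega> \<and>
            hs_hermitian \<tau> \<sigma> \<Omega> (composition_operator \<Phi>) \<longrightarrow>
            ((cmod c)\<^sup>2 = (cmod d)\<^sup>2 \<longrightarrow>
               (\<exists>r::complex. cnj r * (b * cnj d - a * cnj c) \<in> \<real> \<and> (\<forall>w\<in>\<Omega>. \<Phi> w = w + r))) \<and>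
            ((cmod c)\<^sup>2 \<noteq> (cmod d)\<^sup>2 \<longrightarrow>
               (\<exists>r::real. \<forall>w\<in>\<Omega>. \<Phi> w = complex_of_real r * w +
                  complex_of_real (r - 1) * (b * cnj d - a * cnj c) /
                  complex_of_real ((cmod c)\<^sup>2 - (cmod d)\<^sup>2)))) \<and>
         (\<forall>\<Phi>. ((cmod c)\<^sup>2 = (cmod d)\<^sup>2 \<and>
               (\<exists>r::complex. cnj r * (b * cnj d - a * cnj c) \<in> \<real> \<and> (\<forall>w\<in>\<Omega>. \<Phi> w = w + r)) \<or>
             (cmod c)\<^sup>2 \<noteq> (cmod d)\<^sup>2 \<and>
               (\<exists>r::real. \<forall>w\<in>\<Omega>. \<Phi> w = complex_of_real r * w +
                  complex_of_real (r - 1) * (b * cnj d - a * cnj c) /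
                  complex_of_real ((cmod c)\<^sup>2 - (cmod d)\<^sup>2))) \<and>
             \<Phi> ` \<Omega> \<subseteq> \<Omega> \<and> hs_bounded_operator \<tau> \<Omega> (composition_operator \<Phi>) \<longrightarrow>
             hs_hermitian \<tau> \<sigma> \<Omega> (composition_operator \<Phi>))"
proof -
  interpret lf_riemann_map \<Omega> \<tau> \<sigma> a b c d
    using assms by unfold_locales
  have s0: "(cmod c)\<^sup>2 = (cmod d)\<^sup>2 \<longleftrightarrow> s = 0"
    by (simp add: s_def)
  show ?thesis
    unfolding s0 q_def[symmetric] s_def[symmetric]
  proof (intro conjI allI impI; elim conjE)
    fix \<Phi> assume "\<Phi> ` \<Omega> \<subseteq> \<Omega>" "hs_hermitian \<tau> \<sigma> \<Omega> (composition_operator \<Phi>)"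
    note eq = hermitian_imp_D[OF this]
    show "\<exists>r. cnj r * q \<in> \<real> \<and> (\<forall>w\<in>\<Omega>. \<Phi> w = w + r)" if "s = 0"
      using eq that by (rule D_eq_translation)
    show "\<exists>r::real. \<forall>w\<in>\<Omega>. \<Phi> w = of_real r * w + of_real (r - 1) * q / of_real s"
      if "s \<noteq> 0"
      using eq that by (rule D_eq_dilation)
  next
    fix \<Phi>
    assume form: "s = 0 \<and> (\<exists>r. cnj r * q \<in> \<real> \<and> (\<forall>w\<in>\<Omega>. \<Phi> w = w + r)) \<or>
        s \<noteq> 0 \<and>
        (\<exists>r::real. \<forall>w\<in>\<Omega>. \<Phi> w = of_real r * w + of_real (r - 1) * q / of_real s)"
      and self: "\<Phi> ` \<Omega> \<subseteq> \<Omega>" and bdd: "hs_bounded_operator \<tau> \<Omega> (composition_operator \<Phi>)"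
    show "hs_hermitian \<tau> \<sigma> \<Omega> (composition_operator \<Phi>)"
    proof (rule D_imp_hermitian[OF self bdd])
      show "D (\<Phi> v) w = D v (\<Phi> w)" if "v \<in> \<Omega>" "w \<in> \<Omega>" for v w
        using form
      proof (elim disjE conjE exE)
        fix r :: complex
        assume "s = 0" "cnj r * q \<in> \<real>" "\<forall>w\<in>\<Omega>. \<Phi> w = w + r"
        then show ?thesis using that translation_D_eq[of r \<Phi> v w] by blast
      next
        fix r :: real
        assume "s \<noteq> 0"
          "\<forall>w\<in>\<Omega>. \<Phi> w = of_real r * w + of_real (r - 1) * q / of_real s"
        then show ?thesis using that dilation_D_eq[of \<Phi> r v w] by blast
      qed
    qed
  qed
qed

end
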